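(* For all integers $k \geq 2$ and $n \geq 3$ with $(k,n)\neq(3,3)$, we have $W_k(n)=3$; in the exceptional case, $W_3(3)=2$.
   Context: Let $k\ge 1$ be an integer. For a point $p\in\mathbb{R}^2$ and $i=0,\dots,k-1$, let $\ell_i(p)$ be the ray from $p$ in direction $(\cos(2\pi i/k),\sin(2\pi i/k))$. These $k$ rays (the sector-bounding rays of $p$) divide the plane around $p$ into $k$ equal sectors $s_0(p),\dots,s_{k-1}(p)$, where $s_i(p)$ is the sector bounded by $\ell_i(p)$ and the next ray $\ell_{i+1}(p)$ counterclockwise (indices mod $k$). All point sets are finite and in general position (with respect to $k$): no point of the set lies on a sector-bounding ray of another point of the set, and there are no three distinct points $p,q,q'$ in the set such that $q,q'$ lie in the same sector of $p$ and are at the same Euclidean distance from $p$. Given a point set $P$ and a linear order $p_1,\dots,p_n$ of $P$, the corresponding $k$-sector ordered Yao graph is the directed graph on $P$ in which, for every $j$ and every $i$ such that the sector $s_i(p_j)$ contains at least one of the predecessors $p_1,\dots,p_{j-1}$, there is exactly one edge from $p_j$ to its closest (in Euclidean distance) predecessor in $s_i(p_j)$; there are no other edges. A clique in this graph is a set of pairwise adjacent vertices, where the orientation of edges is ignored. $W_k(n)$ is the maximum integer such that for every $n$-point set in the plane there exists an order for which the corresponding $k$-sector ordered Yao graph contains a clique of size $W_k(n)$. *)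

theory Defs
  imports
    "HOL-Analysis.Analysis"
    "HOL-Library.Ramsey"
    "HOL-Combinatorics.Multiset_Permutations"
begin

type_synonym point = "real \<times> real"

definition ray :: "nat \<Rightarrow> nat \<Rightarrow> point \<Rightarrow> point set" where
  "ray k i p =
    {p + t *\<^sub>R (cos (2 * pi * real i / real k), sin (2 * pi * real i / real k)) | t. t \<ge> 0}"

text \<open>
  Sectors are taken to be open. A point set in general position has no point on a
  sector-bounding ray of another of its points, so only the interiors of the sectors matter,
  and with open sectors a point is not in any of its own sectors.
\<close>

definition sector :: "nat \<Rightarrow> nat \<Rightarrow> point \<Rightarrow> point set" where
  "sector k i p =
    {p + t *\<^sub>R (cos \<theta>, sin \<theta>) | t \<theta>.
      t > 0 \<and> 2 * pi * real i / real k < \<theta> \<and> \<theta> < 2 * pi * real (i + 1) / real k}"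

definition general_position :: "nat \<Rightarrow> point set \<Rightarrow> bool" where
  "general_position k P \<longleftrightarrow>
    (\<forall>p\<in>P. \<forall>q\<in>P. p \<noteq> q \<longrightarrow> (\<forall>i<k. q \<notin> ray k i p)) \<and>
    \<not> (\<exists>p\<in>P. \<exists>q\<in>P. \<exists>q'\<in>P. p \<noteq> q \<and> p \<noteq> q' \<and> q \<noteq> q' \<and>
        (\<exists>i<k. q \<in> sector k i p \<and> q' \<in> sector k i p) \<and> dist p q = dist p q')"

text \<open>
  The list \<open>ps\<close> enumerates the point set in its linear order, so \<open>set (take j ps)\<close> consists of
  the predecessors of \<open>ps ! j\<close>. In general position the closest predecessor in a sector is
  unique, so \<open>is_arg_min\<close> yields exactly one edge per sector that contains a predecessor.
\<close>

definition ordered_yao_edges :: "nat \<Rightarrow> point list \<Rightarrow> (point \<times> point) set" where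
  "ordered_yao_edges k ps =
    {(ps ! j, q) | j q. j < length ps \<and>
      (\<exists>i<k. is_arg_min (dist (ps ! j)) (\<lambda>r. r \<in> set (take j ps) \<and> r \<in> sector k i (ps ! j)) q)}"

definition underlying_edges :: "('a \<times> 'a) set \<Rightarrow> 'a set set" where
  "underlying_edges A = {{u, v} | u v. (u, v) \<in> A}"

definition has_yao_clique :: "nat \<Rightarrow> point list \<Rightarrow> nat \<Rightarrow> bool" where
  "has_yao_clique k ps m \<longleftrightarrow>
    (\<exists>C \<subseteq> set ps. card C = m \<and> clique C (underlying_edges (ordered_yao_edges k ps)))"

definition W :: "nat \<Rightarrow> nat \<Rightarrow> nat" where
  "W k n = (GREATEST m. \<forall>P. finite P \<and> card P = n \<and> general_position k P \<longrightarrow>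
    (\<exists>ps \<in> permutations_of_set P. has_yao_clique k ps m))"

end

theory Submission
  imports Defs
begin

text \<open>
  A lower bound on \<open>W k n\<close> asks for a good order of every point set, an upper bound for one
  point set that has no good order.

  \<^bold>\<open>Triangles exist.\<close> If some point \<open>p\<close> sees two points \<open>q\<close>, \<open>r\<close> in different sectors, then
  any order that starts with \<open>q, r, p\<close> contains the triangle \<open>pqr\<close>: with only one predecessor
  in a sector there is nothing closer to compete with. Otherwise each point sees all the others
  in a single sector. Opposite directions lie in sectors whose indices differ by about \<open>k / 2\<close>;
  precisely, \<open>2 (i - j)\<close> differs from an odd multiple of \<open>k\<close> by at most \<open>1\<close>. Adding this
  around a triangle with vertices seeing sectors \<open>i\<close>, \<open>j\<close>, \<open>l\<close>, the index differences cancel and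
  an odd multiple of \<open>k\<close> of absolute value at most \<open>3\<close> remains. This forces
  \<open>k \<le> 3\<close>, and for \<open>k = 2\<close> parity makes that multiple vanish, although it is nonzero
  (\<open>triangle_within_sectors\<close>). For \<open>k = 3\<close> the same relation shows that different points see
  different sectors, which four points cannot do with three sectors
  (\<open>two_points_in_different_sectors\<close>).

  \<^bold>\<open>No larger cliques.\<close> The last vertex of a clique sends an edge to each of its other vertices,
  and a vertex sends at most one edge into each sector. So a clique has at most \<open>d + 1\<close> vertices
  if no point sees the others in more than \<open>d\<close> sectors (\<open>clique_card_le_occupied_sectors\<close>).
  Points on a line in a generic direction see each other in two sectors, so \<open>W k n \<le> 3\<close>. For
  three sectors there is a scalene triangle whose vertices each see the other two in one sector,
  which gives \<open>W 3 3 \<le> 2\<close>.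
\<close>

section \<open>Directions measured in sectors\<close>

text \<open>
  The unit of angle is the opening of a sector: the bounding rays have integer coordinates, a
  half turn is \<open>k / 2\<close>, and comparing sectors becomes arithmetic of integers.
\<close>

definition direction :: "nat \<Rightarrow> real \<Rightarrow> point" where
  "direction k x = (cos (2 * pi * x / real k), sin (2 * pi * x / real k))"

lemma norm_direction [simp]: "norm (direction k x) = 1"
  by (simp add: direction_def norm_Pair)

lemma direction_neq_zero [simp]: "direction k x \<noteq> 0"
  by (metis norm_direction norm_zero zero_neq_one)

lemma direction_eq_imp_congruent:
  assumes "k > 0" "t > 0" "s > 0"
    and eq: "t *\<^sub>R direction k x = s *\<^sub>R direction k y"
  shows "\<exists>m::int. x = y + of_int m * real k"
proof -
  have "t = s"
    using arg_cong[OF eq, of norm] assms(2,3) by simp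
  hence "direction k x = direction k y"
    using eq assms(2) by simp
  then obtain m :: int where "2 * pi * x / real k = 2 * pi * y / real k + 2 * pi * of_int m"
    unfolding direction_def by (metis prod.inject sin_cos_eq_iff mult.assoc)
  hence "2 * pi * (x / real k) = 2 * pi * (y / real k + of_int m)"
    by (simp add: algebra_simps)
  hence "x / real k = y / real k + of_int m"
    by (simp only: mult_cancel_left) simp
  hence "x = y + of_int m * real k"
    using \<open>k > 0\<close> by (simp add: field_simps)
  thus ?thesis ..
qed

lemma minus_direction: "k > 0 \<Longrightarrow> - direction k x = direction k (x + real k / 2)"
proof -
  assume "k > 0"
  hence "2 * pi * (x + real k / 2) / real k = 2 * pi * x / real k + pi"
    by (simp add: field_simps)
  thus ?thesis by (simp add: direction_def)
qed

lemma polar_direction: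
  assumes "k > 0" "v \<noteq> 0"
  obtains t x where "t > 0" "0 \<le> x" "x < real k" "v = t *\<^sub>R direction k x"
proof -
  define t where "t = norm v"
  have "t > 0" using assms(2) by (simp add: t_def)
  have sq: "(fst v)\<^sup>2 + (snd v)\<^sup>2 = t\<^sup>2"
    unfolding t_def by (cases v) (simp add: norm_Pair)
  have "(fst v / t)\<^sup>2 + (snd v / t)\<^sup>2 = 1"
    using \<open>t > 0\<close> sq by (simp add: power_divide flip: add_divide_distrib)
  then obtain \<theta> where \<theta>: "0 \<le> \<theta>" "\<theta> < 2 * pi" "fst v / t = cos \<theta>" "snd v / t = sin \<theta>"
    by (metis sincos_total_2pi)
  define x where "x = \<theta> * real k / (2 * pi)"
  have x: "2 * pi * x / real k = \<theta>"
    using assms(1) by (simp add: x_def)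
  have "x < real k"
    using \<theta>(2) assms(1) by (simp add: x_def divide_simps)
  moreover have "v = t *\<^sub>R direction k x"
    using \<theta>(3,4) \<open>t > 0\<close> unfolding direction_def x by (cases v) (simp add: field_simps)
  moreover have "0 \<le> x" using \<theta>(1) by (simp add: x_def)
  ultimately show thesis using that \<open>t > 0\<close> by blast
qed

lemma ray_iff: "q \<in> ray k i p \<longleftrightarrow> (\<exists>t\<ge>0. q = p + t *\<^sub>R direction k (real i))"
  by (auto simp: ray_def direction_def)

lemma sector_iff:
  assumes "k > 0"
  shows "q \<in> sector k i p \<longleftrightarrow>
    (\<exists>t x. t > 0 \<and> real i < x \<and> x < real i + 1 \<and> q = p + t *\<^sub>R direction k x)"
proof
  assume "q \<in> sector k i p"
  then obtain t \<theta> where *: "t > 0" "2 * pi * real i / real k < \<theta>"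
      "\<theta> < 2 * pi * real (i + 1) / real k" "q = p + t *\<^sub>R (cos \<theta>, sin \<theta>)"
    unfolding sector_def by blast
  define x where "x = \<theta> * real k / (2 * pi)"
  have x: "2 * pi * x / real k = \<theta>"
    using assms by (simp add: x_def)
  have "real i < x" "x < real i + 1"
    using * assms by (simp_all add: x_def field_simps)
  with * x show "\<exists>t x. t > 0 \<and> real i < x \<and> x < real i + 1 \<and> q = p + t *\<^sub>R direction k x"
    unfolding direction_def by metis
next
  assume "\<exists>t x. t > 0 \<and> real i < x \<and> x < real i + 1 \<and> q = p + t *\<^sub>R direction k x"
  then obtain t x where *: "t > 0" "real i < x" "x < real i + 1" "q = p + t *\<^sub>R direction k x"
    by blast
  have "2 * pi * real i / real k < 2 * pi * x / real k"
    "2 * pi * x / real k < 2 * pi * real (i + 1) / real k"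
    using * assms by (simp_all add: divide_strict_right_mono)
  with * show "q \<in> sector k i p"
    unfolding sector_def direction_def by blast
qed

text \<open>
  Two coordinates of the same direction differ by a multiple of \<open>k\<close>, so the indices of two
  sectors containing it are congruent modulo \<open>k\<close>.
\<close>

lemma sector_index_unique:
  assumes "k > 0" "i < k" "j < k" "q \<in> sector k i p" "q \<in> sector k j p"
  shows "i = j"
proof -
  obtain t x s y where *: "t > 0" "real i < x" "x < real i + 1"
      "s > 0" "real j < y" "y < real j + 1"
      and eq: "t *\<^sub>R direction k x = s *\<^sub>R direction k y"
    using assms(4,5) unfolding sector_iff[OF assms(1)] by auto
  obtain m :: int where m: "x = y + of_int m * real k"
    using direction_eq_imp_congruent[OF assms(1) _ _ eq] * by blast
  have "\<bar>real_of_int (int i - int j - m * int k)\<bar> < 1"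
    using * m by (simp add: algebra_simps)
  hence e: "int i - int j = m * int k" by linarith
  have "\<bar>int i - int j\<bar> < int k" using assms(2,3) by linarith
  with e have "int i - int j = 0"
    by (metis dvd_imp_le_int dvd_triv_right abs_of_nat not_le)
  thus ?thesis by simp
qed

lemma not_on_ray_of_in_sector:
  assumes "k > 0" "i < k" "j < k" "q \<in> sector k i p"
  shows "q \<notin> ray k j p"
proof
  assume "q \<in> ray k j p"
  obtain t x where *: "t > 0" "real i < x" "x < real i + 1" "q = p + t *\<^sub>R direction k x"
    using assms(4) unfolding sector_iff[OF assms(1)] by blast
  obtain s where s: "s \<ge> 0" "q = p + s *\<^sub>R direction k (real j)"
    using \<open>q \<in> ray k j p\<close> unfolding ray_iff by blast
  have eq: "t *\<^sub>R direction k x = s *\<^sub>R direction k (real j)"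
    using * s by simp
  with * s have "s > 0"
    by (cases "s = 0") auto
  then obtain m :: int where m: "x = real j + of_int m * real k"
    using direction_eq_imp_congruent[OF assms(1) _ _ eq] * by blast
  hence "real_of_int (int i) < real_of_int (int j + m * int k)"
    "real_of_int (int j + m * int k) < real_of_int (int i + 1)"
    using * by simp_all
  hence "int i < int j + m * int k" "int j + m * int k < int i + 1"
    by (simp_all only: of_int_less_iff)
  thus False by linarith
qed

lemma not_in_own_sector: "k > 0 \<Longrightarrow> p \<notin> sector k i p"
proof
  assume "k > 0" "p \<in> sector k i p"
  then obtain t x where "t > 0" "t *\<^sub>R direction k x = 0"
    by (auto simp: sector_iff)
  thus False by simp
qed

text \<open>
  The sector is found by rounding down the angular coordinate; general position excludes
  integer coordinates, which belong to bounding rays.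
\<close>

lemma in_some_sector:
  assumes "k > 0" "general_position k P" "p \<in> P" "q \<in> P" "p \<noteq> q"
  obtains i where "i < k" "q \<in> sector k i p"
proof -
  obtain t x where *: "t > 0" "0 \<le> x" "x < real k" "q - p = t *\<^sub>R direction k x"
    using polar_direction[OF assms(1), of "q - p"] assms(5) by auto
  define i where "i = nat \<lfloor>x\<rfloor>"
  have i: "real i \<le> x" "x < real i + 1"
    using * by (simp_all add: i_def)
  hence "i < k" using * by linarith
  have q: "q = p + t *\<^sub>R direction k x"
    using *(4) by (simp add: algebra_simps)
  have "x \<noteq> real i"
  proof
    assume "x = real i"
    hence "q \<in> ray k i p"
      using q \<open>t > 0\<close> unfolding ray_iff by (metis less_imp_le)
    thus False
      using assms \<open>i < k\<close> unfolding general_position_def by blast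
  qed
  hence "q \<in> sector k i p"
    using i q \<open>t > 0\<close> unfolding sector_iff[OF assms(1)]
    by (metis order.order_iff_strict)
  thus thesis using that \<open>i < k\<close> by blast
qed

section \<open>Points seeing each other in given sectors\<close>

text \<open>
  Looking back is a half turn, which adds \<open>k / 2\<close> modulo \<open>k\<close> to the coordinate. Rounding to
  indices costs strictly less than \<open>1\<close>; doubling turns the half into an odd multiple of \<open>k\<close> and
  gives a difference of integers that is strictly less than \<open>2\<close>.
\<close>

lemma opposite_sector_indices:
  assumes "k > 0" "q \<in> sector k i p" "p \<in> sector k j q"
  shows "\<exists>m::int. odd m \<and> \<bar>2 * (int i - int j) + int k * m\<bar> \<le> 1"
proof -
  obtain t x s y where *: "t > 0" "real i < x" "x < real i + 1"
      "s > 0" "real j < y" "y < real j + 1"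
      and q: "q = p + t *\<^sub>R direction k x" and p: "p = q + s *\<^sub>R direction k y"
    using assms(2,3) unfolding sector_iff[OF assms(1)] by blast
  have "s *\<^sub>R direction k y = - (t *\<^sub>R direction k x)"
    using p q by (metis add_diff_cancel_left' minus_diff_eq)
  hence eq: "s *\<^sub>R direction k y = t *\<^sub>R direction k (x + real k / 2)"
    by (simp add: minus_direction[OF assms(1), symmetric])
  obtain m :: int where m: "y = x + real k / 2 + of_int m * real k"
    using direction_eq_imp_congruent[OF assms(1) _ _ eq] * by blast
  have "\<bar>real_of_int (2 * (int i - int j) + int k * (2 * m + 1))\<bar> < 2"
    using * m by (simp add: algebra_simps)
  hence "\<bar>2 * (int i - int j) + int k * (2 * m + 1)\<bar> \<le> 1" by linarith
  thus ?thesis by (intro exI[of _ "2 * m + 1"]) simp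
qed

lemma opposite_sectors_differ:
  assumes "k \<ge> 2" "q \<in> sector k i p" "p \<in> sector k j q"
  shows "i \<noteq> j"
proof
  assume "i = j"
  then obtain m :: int where m: "odd m" "\<bar>int k * m\<bar> \<le> 1"
    using opposite_sector_indices[of k q i p j] assms by auto
  have "int k * 1 \<le> int k * \<bar>m\<bar>"
    using m(1) by (intro mult_left_mono) (cases "m = 0", auto)
  with m(2) assms(1) show False by (simp add: abs_mult)
qed

text \<open>
  The case \<open>k = 3\<close> does occur: it is the triangle behind the exceptional value \<open>W 3 3 = 2\<close>.
\<close>

lemma triangle_within_sectors:
  assumes "k > 0"
    and "b \<in> sector k i a" "c \<in> sector k i a"
    and "a \<in> sector k j b" "c \<in> sector k j b"
    and "a \<in> sector k l c" "b \<in> sector k l c"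
  shows "k = 1 \<or> k = 3"
proof -
  obtain m1 :: int where m1: "odd m1" "\<bar>2 * (int i - int j) + int k * m1\<bar> \<le> 1"
    using opposite_sector_indices[of k b i a j] assms by blast
  obtain m2 :: int where m2: "odd m2" "\<bar>2 * (int j - int l) + int k * m2\<bar> \<le> 1"
    using opposite_sector_indices[of k c j b l] assms by blast
  obtain m3 :: int where m3: "odd m3" "\<bar>2 * (int l - int i) + int k * m3\<bar> \<le> 1"
    using opposite_sector_indices[of k a l c i] assms by blast
  \<comment> \<open>In the sum of the three relations the sector indices cancel.\<close>
  define m where "m = m1 + m2 + m3"
  have "odd m" using m1 m2 m3 by (simp add: m_def)
  have sum: "int k * m = (2 * (int i - int j) + int k * m1) +
      (2 * (int j - int l) + int k * m2) + (2 * (int l - int i) + int k * m3)"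
    by (simp add: m_def algebra_simps)
  have "int k * 1 \<le> int k * \<bar>m\<bar>"
    using \<open>odd m\<close> by (intro mult_left_mono) (cases "m = 0", auto)
  also have "\<dots> = \<bar>int k * m\<bar>" by (simp add: abs_mult)
  also have "\<dots> \<le> 3" unfolding sum using m1(2) m2(2) m3(2) by linarith
  finally have "k \<le> 3" by simp
  moreover have "k \<noteq> 2"
  proof
    assume "k = 2"
    \<comment> \<open>Twice each left-hand side is at most 1 in absolute value.\<close>
    have "int i - int j + m1 = 0" "int j - int l + m2 = 0" "int l - int i + m3 = 0"
      using \<open>k = 2\<close> m1(2) m2(2) m3(2) by simp_all
    hence "m = 0" by (simp add: m_def)
    with \<open>odd m\<close> show False by simp
  qed
  ultimately show ?thesis using assms(1) by linarith
qed

text \<open>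
  In a counterexample each point \<open>p\<close> sees all the others in one sector \<open>s p\<close>, and \<open>s\<close> is
  injective because two points never see each other in sectors of the same index.
\<close>

lemma two_points_in_different_sectors:
  assumes "k \<ge> 2" "finite P" "card P \<ge> 3" "(k, card P) \<noteq> (3, 3)" "general_position k P"
  obtains p q r i j where "p \<in> P" "q \<in> P" "r \<in> P" "i < k" "j < k" "i \<noteq> j"
    "q \<in> sector k i p" "r \<in> sector k j p"
proof (rule ccontr)
  note witness = that
  assume contra: "\<not> thesis"
  have "k > 0" using assms(1) by simp
  have same: "i = j"
    if "p \<in> P" "q \<in> P" "r \<in> P" "i < k" "j < k" "q \<in> sector k i p" "r \<in> sector k j p"
    for p q r i j
    using contra witness that by blast
  have "\<exists>i<k. \<forall>q\<in>P - {p}. q \<in> sector k i p" if "p \<in> P" for p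
  proof -
    have "card (P - {p}) > 0"
      using assms(2,3) that by simp
    then obtain q where q: "q \<in> P" "p \<noteq> q"
      by (metis card_gt_0_iff Diff_iff ex_in_conv singletonI)
    obtain i where i: "i < k" "q \<in> sector k i p"
      using in_some_sector[OF \<open>k > 0\<close> assms(5) \<open>p \<in> P\<close> q] .
    have "r \<in> sector k i p" if r: "r \<in> P - {p}" for r
    proof -
      obtain j where "j < k" "r \<in> sector k j p"
        using in_some_sector[OF \<open>k > 0\<close> assms(5) \<open>p \<in> P\<close>, of r] r by blast
      with same[of p q r i j] i q r \<open>p \<in> P\<close> show ?thesis by blast
    qed
    with i show ?thesis by blast
  qed
  then obtain s where s: "\<And>p. p \<in> P \<Longrightarrow> s p < k"
      "\<And>p q. p \<in> P \<Longrightarrow> q \<in> P \<Longrightarrow> p \<noteq> q \<Longrightarrow> q \<in> sector k (s p) p"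
    by (metis Diff_iff singletonD)
  show False
  proof (cases "k = 3")
    case True
    have "inj_on s P"
      using opposite_sectors_differ[OF assms(1)] s(2) by (metis inj_onI)
    hence "card P \<le> card {..<k}"
      using s(1) by (intro card_inj_on_le[of s]) auto
    with assms(3,4) True show False by simp
  next
    case False
    obtain T where "T \<subseteq> P" "card T = 3"
      using obtain_subset_with_card_n[OF assms(3)] by blast
    then obtain a b c where "a \<in> P" "b \<in> P" "c \<in> P" "a \<noteq> b" "a \<noteq> c" "b \<noteq> c"
      by (auto simp: card_3_iff)
    hence "k = 1 \<or> k = 3"
      using triangle_within_sectors[OF \<open>k > 0\<close>, of b "s a" a c "s b" "s c"] s(2) by metis
    with False assms(1) show False by simp
  qed
qed

section \<open>Orders with a large clique\<close>

text \<open>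
  The only predecessor in a sector is the closest one, whatever its distance.
\<close>

lemma ordered_yao_edgeI:
  assumes "j < length ps" "i < k" "q \<in> set (take j ps)" "q \<in> sector k i (ps ! j)"
    and "\<And>r. r \<in> set (take j ps) \<Longrightarrow> r \<in> sector k i (ps ! j) \<Longrightarrow> r = q"
  shows "{ps ! j, q} \<in> underlying_edges (ordered_yao_edges k ps)"
proof -
  have "is_arg_min (dist (ps ! j)) (\<lambda>r. r \<in> set (take j ps) \<and> r \<in> sector k i (ps ! j)) q"
    unfolding is_arg_min_def using assms(3-5) by (metis less_irrefl)
  hence "(ps ! j, q) \<in> ordered_yao_edges k ps"
    using assms(1,2) unfolding ordered_yao_edges_def by blast
  thus ?thesis unfolding underlying_edges_def by blast
qed

lemma order_with_prefix:
  assumes "finite P" "distinct ps" "set ps \<subseteq> P"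
  shows "\<exists>qs. ps @ qs \<in> permutations_of_set P"
proof -
  obtain qs where "set qs = P - set ps" "distinct qs"
    using assms(1) finite_distinct_list[of "P - set ps"] by auto
  hence "ps @ qs \<in> permutations_of_set P"
    using assms by (intro permutations_of_setI) auto
  thus ?thesis ..
qed

lemma edge_between_first_two:
  assumes "k > 0" "general_position k P" "q \<in> P" "r \<in> P" "q \<noteq> r"
  shows "{r, q} \<in> underlying_edges (ordered_yao_edges k (q # r # qs))"
proof -
  obtain i where "i < k" "q \<in> sector k i r"
    using in_some_sector[OF assms(1,2), of r q] assms by blast
  hence "{(q # r # qs) ! 1, q} \<in> underlying_edges (ordered_yao_edges k (q # r # qs))"
    by (intro ordered_yao_edgeI[of 1 _ i]) simp_all
  thus ?thesis by simp
qed

lemma order_with_triangle: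
  assumes "k \<ge> 2" "finite P" "card P \<ge> 3" "(k, card P) \<noteq> (3, 3)" "general_position k P"
  shows "\<exists>ps\<in>permutations_of_set P. has_yao_clique k ps 3"
proof -
  have "k > 0" using assms(1) by simp
  obtain p q r i j where *: "p \<in> P" "q \<in> P" "r \<in> P" "i < k" "j < k" "i \<noteq> j"
    "q \<in> sector k i p" "r \<in> sector k j p"
    using two_points_in_different_sectors[OF assms] .
  have nin: "r \<notin> sector k i p" "q \<notin> sector k j p"
    using * sector_index_unique[OF \<open>k > 0\<close> \<open>i < k\<close> \<open>j < k\<close>] by metis+
  have neq: "q \<noteq> r" "p \<noteq> q" "p \<noteq> r"
    using *(7,8) nin not_in_own_sector[OF \<open>k > 0\<close>] by metis+
  obtain qs where ps: "[q, r, p] @ qs \<in> permutations_of_set P"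
    using order_with_prefix[OF assms(2), of "[q, r, p]"] * neq by auto
  define ps where "ps = [q, r, p] @ qs"
  let ?E = "underlying_edges (ordered_yao_edges k ps)"
  have "{r, q} \<in> ?E"
    using edge_between_first_two[OF \<open>k > 0\<close> assms(5)] * neq by (simp add: ps_def)
  moreover have "{p, q} \<in> ?E"
  proof -
    have "x = q" if "x \<in> set (take 2 ps)" "x \<in> sector k i p" for x
      using that nin by (auto simp: ps_def)
    hence "{ps ! 2, q} \<in> ?E"
      by (intro ordered_yao_edgeI[of 2 _ i]) (use * in \<open>simp_all add: ps_def\<close>)
    thus ?thesis by (simp add: ps_def)
  qed
  moreover have "{p, r} \<in> ?E"
  proof -
    have "x = r" if "x \<in> set (take 2 ps)" "x \<in> sector k j p" for x
      using that nin by (auto simp: ps_def)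
    hence "{ps ! 2, r} \<in> ?E"
      by (intro ordered_yao_edgeI[of 2 _ j]) (use * in \<open>simp_all add: ps_def\<close>)
    thus ?thesis by (simp add: ps_def)
  qed
  ultimately have "clique {p, q, r} ?E"
    unfolding clique_def by (metis insert_commute insert_iff singletonD)
  moreover have "{p, q, r} \<subseteq> set ps" "card {p, q, r} = 3"
    using neq by (auto simp: ps_def)
  ultimately have "has_yao_clique k ps 3"
    unfolding has_yao_clique_def by blast
  with ps show ?thesis unfolding ps_def by blast
qed

lemma order_with_adjacent_pair:
  assumes "k > 0" "finite P" "card P \<ge> 2" "general_position k P"
  shows "\<exists>ps\<in>permutations_of_set P. has_yao_clique k ps 2"
proof -
  obtain T where "T \<subseteq> P" "card T = 2"
    using obtain_subset_with_card_n[OF assms(3)] by blast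
  then obtain q r where *: "q \<in> P" "r \<in> P" "q \<noteq> r"
    by (auto simp: card_2_iff)
  obtain qs where ps: "[q, r] @ qs \<in> permutations_of_set P"
    using order_with_prefix[OF assms(2), of "[q, r]"] * by auto
  have "{r, q} \<in> underlying_edges (ordered_yao_edges k ([q, r] @ qs))"
    using edge_between_first_two[OF assms(1,4)] * by simp
  hence "clique {q, r} (underlying_edges (ordered_yao_edges k ([q, r] @ qs)))"
    unfolding clique_def by (metis insert_commute insert_iff singletonD)
  moreover have "{q, r} \<subseteq> set ([q, r] @ qs)" "card {q, r} = 2"
    using * by auto
  ultimately have "has_yao_clique k ([q, r] @ qs) 2"
    unfolding has_yao_clique_def by blast
  with ps show ?thesis by blast
qed

section \<open>Bounding cliques by occupied sectors\<close>

definition occupied_sectors :: "nat \<Rightarrow> point set \<Rightarrow> point \<Rightarrow> nat set" where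
  "occupied_sectors k P p = {i. i < k \<and> sector k i p \<inter> P \<noteq> {}}"

lemma finite_occupied_sectors: "finite (occupied_sectors k P p)"
  by (rule finite_subset[of _ "{..<k}"]) (auto simp: occupied_sectors_def)

text \<open>
  The clique vertex that comes last in the order must be the source of all its clique edges.
  Distinct targets lie in distinct sectors because, in general position, at most one point of a
  sector is closest.
\<close>

lemma clique_card_le_occupied_sectors:
  assumes "k > 0" "general_position k P" "ps \<in> permutations_of_set P" "has_yao_clique k ps m"
    and occ: "\<And>p. p \<in> P \<Longrightarrow> card (occupied_sectors k P p) \<le> d"
  shows "m \<le> d + 1"
proof -
  have P: "set ps = P" "distinct ps"
    using assms(3) by (auto simp: permutations_of_set_def)
  obtain C where C: "C \<subseteq> P" "card C = m" "clique C (underlying_edges (ordered_yao_edges k ps))"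
    using assms(4) P unfolding has_yao_clique_def by blast
  show ?thesis
  proof (cases "C = {}")
    case True
    thus ?thesis using C by simp
  next
    case False
    define J where "J = {j. j < length ps \<and> ps ! j \<in> C}"
    have "finite J" by (simp add: J_def)
    moreover have "J \<noteq> {}"
      using False C(1) P(1) by (fastforce simp: J_def in_set_conv_nth)
    ultimately have "Max J \<in> J" and Max: "\<And>j. j \<in> J \<Longrightarrow> j \<le> Max J"
      by simp_all
    define j where "j = Max J"
    define v where "v = ps ! j"
    have j: "j < length ps" "v \<in> C"
      using \<open>Max J \<in> J\<close> by (simp_all add: J_def j_def v_def)
    let ?argmin = "\<lambda>i w. is_arg_min (dist v) (\<lambda>r. r \<in> set (take j ps) \<and> r \<in> sector k i v) w"
    have "\<exists>i<k. ?argmin i w" if w: "w \<in> C - {v}" for w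
    proof -
      have "{v, w} \<in> underlying_edges (ordered_yao_edges k ps)"
        using C(3) w j by (auto simp: clique_def)
      hence "(v, w) \<in> ordered_yao_edges k ps \<or> (w, v) \<in> ordered_yao_edges k ps"
        by (auto simp: underlying_edges_def doubleton_eq_iff)
      moreover have "(w, v) \<notin> ordered_yao_edges k ps"
      proof
        assume "(w, v) \<in> ordered_yao_edges k ps"
        then obtain j' where j': "j' < length ps" "w = ps ! j'" "v \<in> set (take j' ps)"
          by (auto simp: ordered_yao_edges_def is_arg_min_def)
        then obtain l where "l < j'" "v = ps ! l"
          by (auto simp: in_set_conv_nth)
        with j' j have "l = j"
          using P(2) by (simp add: v_def nth_eq_iff_index_eq)
        moreover have "j' \<le> j"
          using Max[of j'] j' w by (simp add: J_def j_def)
        ultimately show False using \<open>l < j'\<close> by simp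
      qed
      ultimately have "(v, w) \<in> ordered_yao_edges k ps" by blast
      then obtain j' i where j': "j' < length ps" "v = ps ! j'" "i < k"
          "is_arg_min (dist (ps ! j')) (\<lambda>r. r \<in> set (take j' ps) \<and> r \<in> sector k i (ps ! j')) w"
        by (auto simp: ordered_yao_edges_def)
      moreover have "j' = j"
        using j' j P(2) by (simp add: v_def nth_eq_iff_index_eq)
      ultimately show ?thesis by blast
    qed
    then obtain f where f: "\<And>w. w \<in> C - {v} \<Longrightarrow> f w < k" "\<And>w. w \<in> C - {v} \<Longrightarrow> ?argmin (f w) w"
      by metis
    have sec: "w \<in> sector k (f w) v" if "w \<in> C - {v}" for w
      using f(2)[OF that] by (simp add: is_arg_min_def)
    have "inj_on f (C - {v})"
    proof (rule inj_onI, rule ccontr)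
      fix w w' assume w: "w \<in> C - {v}" "w' \<in> C - {v}" "f w = f w'" "w \<noteq> w'"
      have "dist v w = dist v w'"
        using f(2)[OF w(1)] f(2)[OF w(2)] w(3) unfolding is_arg_min_def
        by (metis linorder_neqE)
      moreover have "w \<in> sector k (f w) v" "w' \<in> sector k (f w) v" "f w < k"
        using sec[OF w(1)] sec[OF w(2)] f(1)[OF w(1)] w(3) by simp_all
      moreover have "v \<in> P" "w \<in> P" "w' \<in> P" "v \<noteq> w" "v \<noteq> w'"
        using w j C(1) by auto
      ultimately show False
        using assms(2) w(4) unfolding general_position_def by blast
    qed
    moreover have "f ` (C - {v}) \<subseteq> occupied_sectors k P v"
      using f(1) sec C(1) by (fastforce simp: occupied_sectors_def)
    ultimately have "card (C - {v}) \<le> card (occupied_sectors k P v)"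
      using card_inj_on_le finite_occupied_sectors by blast
    also have "\<dots> \<le> d" using occ j C(1) by blast
    finally show ?thesis using j C(2) by simp
  qed
qed

text \<open>
  Locating every point in a sector settles the condition on bounding rays, which are disjoint
  from all sectors.
\<close>

lemma general_positionI:
  assumes "k > 0"
    and "\<And>p q. p \<in> P \<Longrightarrow> q \<in> P \<Longrightarrow> p \<noteq> q \<Longrightarrow> \<exists>i<k. q \<in> sector k i p"
    and "\<And>p q r i. p \<in> P \<Longrightarrow> q \<in> P \<Longrightarrow> r \<in> P \<Longrightarrow> q \<noteq> r \<Longrightarrow> i < k \<Longrightarrow>
      q \<in> sector k i p \<Longrightarrow> r \<in> sector k i p \<Longrightarrow> dist p q \<noteq> dist p r"
  shows "general_position k P"
  unfolding general_position_def
  using not_on_ray_of_in_sector[OF assms(1)] assms(2,3) by blast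

section \<open>Point sets without large cliques\<close>

text \<open>
  The line has coordinate \<open>1 / 4\<close> in one direction and \<open>1 / 4 + k / 2\<close> in the other. Neither is
  an integer, whatever the parity of \<open>k\<close>, so the line follows no bounding ray; the sectors are
  those with indices \<open>0\<close> and \<open>k div 2\<close>.
\<close>

definition line_point :: "nat \<Rightarrow> nat \<Rightarrow> point" where
  "line_point k m = real m *\<^sub>R direction k (1 / 4)"

lemma dist_line_point: "dist (line_point k m) (line_point k l) = \<bar>real m - real l\<bar>"
proof -
  have "dist (line_point k m) (line_point k l) = norm ((real m - real l) *\<^sub>R direction k (1 / 4))"
    by (simp add: line_point_def dist_norm scaleR_left_diff_distrib)
  thus ?thesis by simp
qed

lemma line_point_sector_up:
  assumes "k > 0" "m < l"
  shows "line_point k l \<in> sector k 0 (line_point k m)"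
proof -
  have "line_point k l = line_point k m + (real l - real m) *\<^sub>R direction k (1 / 4)"
    by (simp add: line_point_def algebra_simps)
  moreover have "real l - real m > 0" using assms by simp
  ultimately show ?thesis
    unfolding sector_iff[OF assms(1)]
    by (intro exI[of _ "real l - real m"] exI[of _ "1 / 4"]) simp
qed

lemma line_point_sector_down:
  assumes "k > 0" "m < l"
  shows "line_point k m \<in> sector k (k div 2) (line_point k l)"
proof -
  have "line_point k m = line_point k l + (real l - real m) *\<^sub>R (- direction k (1 / 4))"
    by (simp add: line_point_def algebra_simps)
  moreover have "real l - real m > 0" using assms by simp
  moreover have "real (k div 2) < 1 / 4 + real k / 2" "1 / 4 + real k / 2 < real (k div 2) + 1"
    by linarith+
  ultimately show ?thesis
    unfolding sector_iff[OF assms(1)] minus_direction[OF assms(1)] by blast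
qed

lemma line_point_sector:
  assumes "k \<ge> 2" "i < k" "line_point k l \<in> sector k i (line_point k m)"
  shows "m < l \<and> i = 0 \<or> l < m \<and> i = k div 2"
proof -
  have "k > 0" using assms(1) by simp
  consider "m < l" | "l < m" | "l = m" by linarith
  thus ?thesis
    using assms line_point_sector_up[OF \<open>k > 0\<close>] line_point_sector_down[OF \<open>k > 0\<close>]
      sector_index_unique[OF \<open>k > 0\<close>, of i] not_in_own_sector[OF \<open>k > 0\<close>]
    by cases (metis \<open>k > 0\<close>, metis \<open>k > 0\<close> div_less_dividend one_less_numeral_iff semiring_norm(76), auto)
qed

lemma line_in_general_position:
  assumes "k \<ge> 2"
  shows "general_position k (line_point k ` {..<n})"
proof (rule general_positionI)
  show "k > 0" using assms by simp
  fix p q assume "p \<in> line_point k ` {..<n}" "q \<in> line_point k ` {..<n}" "p \<noteq> q"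
  then obtain m l where "p = line_point k m" "q = line_point k l" "m < l \<or> l < m"
    by (metis image_iff nat_neq_iff)
  thus "\<exists>i<k. q \<in> sector k i p"
    using line_point_sector_up[OF \<open>k > 0\<close>] line_point_sector_down[OF \<open>k > 0\<close>] \<open>k > 0\<close>
    by (metis div_less_dividend one_less_numeral_iff semiring_norm(76))
next
  fix p q r i
  assume *: "p \<in> line_point k ` {..<n}" "q \<in> line_point k ` {..<n}" "r \<in> line_point k ` {..<n}"
    "q \<noteq> r" "i < k" "q \<in> sector k i p" "r \<in> sector k i p"
  then obtain m l l' where pqr: "p = line_point k m" "q = line_point k l" "r = line_point k l'"
    by blast
  hence "m < l \<and> i = 0 \<or> l < m \<and> i = k div 2" "m < l' \<and> i = 0 \<or> l' < m \<and> i = k div 2"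
    using line_point_sector[OF assms] * by blast+
  moreover have "k div 2 \<noteq> 0" using assms by simp
  moreover have "l \<noteq> l'" using pqr * by blast
  ultimately show "dist p q \<noteq> dist p r"
    unfolding pqr dist_line_point by auto
qed

lemma line_occupied_sectors:
  assumes "k \<ge> 2" "p \<in> line_point k ` {..<n}"
  shows "card (occupied_sectors k (line_point k ` {..<n}) p) \<le> 2"
proof -
  have "occupied_sectors k (line_point k ` {..<n}) p \<subseteq> {0, k div 2}"
  proof
    fix i assume "i \<in> occupied_sectors k (line_point k ` {..<n}) p"
    then obtain l where "i < k" "line_point k l \<in> sector k i p"
      unfolding occupied_sectors_def by blast
    moreover obtain m where "p = line_point k m" using assms(2) by blast
    ultimately show "i \<in> {0, k div 2}"
      using line_point_sector[OF assms(1), of i l m] by blast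
  qed
  hence "card (occupied_sectors k (line_point k ` {..<n}) p) \<le> card {0, k div 2}"
    by (intro card_mono) auto
  also have "\<dots> \<le> 2" by (rule order.trans[OF card_insert_le_m1]) auto
  finally show ?thesis .
qed

lemma card_line: "card (line_point k ` {..<n}) = n"
proof -
  have "inj (line_point k)"
  proof (rule injI)
    fix m l assume "line_point k m = line_point k l"
    thus "m = l" using dist_line_point[of k m l] by simp
  qed
  thus ?thesis by (simp add: card_image inj_on_subset)
qed

text \<open>
  For \<open>k \<ge> 3\<close> a sector is a convex cone with opening less than \<open>pi\<close>, so it contains the positive
  combinations of its bounding directions. This certifies membership in a sector by exact
  coordinates, without computing any angle.
\<close>

lemma positive_combination_in_sector:
  assumes "k \<ge> 3" "a > 0" "b > 0"
    and q: "q = p + a *\<^sub>R direction k (real i) + b *\<^sub>R direction k (real i + 1)"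
  shows "q \<in> sector k i p"
proof -
  define \<delta> where "\<delta> = 2 * pi / real k"
  have \<delta>: "0 < \<delta>" "\<delta> < pi"
    using assms(1) by (simp_all add: \<delta>_def field_simps)
  have "k > 0" using assms(1) by simp
  \<comment> \<open>The direction with coordinate \<open>x + k / 4\<close> is orthogonal to the one with coordinate \<open>x\<close>.\<close>
  have rot: "direction k (x + y) =
      cos (y * \<delta>) *\<^sub>R direction k x + sin (y * \<delta>) *\<^sub>R direction k (x + real k / 4)" for x y
  proof -
    have "2 * pi * (x + y) / real k = 2 * pi * x / real k + y * \<delta>"
      "2 * pi * (x + real k / 4) / real k = 2 * pi * x / real k + pi / 2"
      using \<open>k > 0\<close> by (simp_all add: \<delta>_def field_simps)
    thus ?thesis by (simp add: direction_def cos_add sin_add algebra_simps)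
  qed
  have "sin \<delta> > 0" using \<delta> by (intro sin_gt_zero)
  \<comment> \<open>These are the coordinates of \<open>q - p\<close> in the orthonormal frame at the bounding ray \<open>i\<close>; the
    angle \<open>y * \<delta>\<close> of this vector has to be located strictly between \<open>0\<close> and \<open>\<delta>\<close>.\<close>
  have "(a + b * cos \<delta>, b * sin \<delta>) \<noteq> 0"
    using \<open>sin \<delta> > 0\<close> \<open>b > 0\<close> by (simp add: zero_prod_def)
  then obtain t y where ty: "t > 0" "0 \<le> y" "y < real k"
      "(a + b * cos \<delta>, b * sin \<delta>) = t *\<^sub>R direction k y"
    using polar_direction[OF \<open>k > 0\<close>] by metis
  have y: "2 * pi * y / real k = y * \<delta>" by (simp add: \<delta>_def)
  have c: "a + b * cos \<delta> = t * cos (y * \<delta>)" "b * sin \<delta> = t * sin (y * \<delta>)"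
    using ty(4) by (simp_all add: direction_def y)
  have "y * \<delta> < 2 * pi"
    using ty(3) \<open>k > 0\<close> by (simp add: \<delta>_def field_simps)
  have "sin (y * \<delta>) > 0"
    using c(2) \<open>sin \<delta> > 0\<close> \<open>b > 0\<close> ty(1) by (metis mult_pos_pos zero_less_mult_pos)
  hence "y * \<delta> < pi" 
    using \<open>y * \<delta> < 2 * pi\<close> sin_le_zero[of "y * \<delta>"] by linarith
  have "y \<noteq> 0" using \<open>sin (y * \<delta>) > 0\<close> by auto
  have "t * sin (\<delta> - y * \<delta>) = sin \<delta> * (t * cos (y * \<delta>)) - cos \<delta> * (t * sin (y * \<delta>))"
    by (simp add: sin_diff algebra_simps)
  also have "\<dots> = a * sin \<delta>"
    unfolding c[symmetric] by (simp add: algebra_simps)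
  finally have "sin (\<delta> - y * \<delta>) > 0"
    using \<open>sin \<delta> > 0\<close> \<open>a > 0\<close> ty(1) by (metis mult_pos_pos zero_less_mult_pos)
  hence "y * \<delta> < \<delta>"
    using sin_gt_zero[of "y * \<delta> - \<delta>"] \<open>y * \<delta> < pi\<close> \<delta> sin_minus[of "\<delta> - y * \<delta>"]
    by (cases "y * \<delta> = \<delta>") fastforce+
  hence "y < 1" using \<delta> by simp
  have "q = p + (a + b * cos \<delta>) *\<^sub>R direction k (real i) + (b * sin \<delta>) *\<^sub>R direction k (real i + real k / 4)"
    unfolding q rot[of "real i" 1] by (simp add: algebra_simps)
  also have "\<dots> = p + t *\<^sub>R direction k (real i + y)"
    unfolding c rot[of "real i" y] by (simp add: algebra_simps)
  finally show ?thesis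
    unfolding sector_iff[OF \<open>k > 0\<close>] using ty \<open>y \<noteq> 0\<close> \<open>y < 1\<close>
    by (intro exI[of _ t] exI[of _ "real i + y"]) auto
qed

text \<open>
  Let \<open>e0\<close>, \<open>e1\<close>, \<open>e2\<close> be the bounding directions for three sectors, so that
  \<open>e0 + e1 + e2 = 0\<close>. The sides of the triangle are \<open>B - A = 4 e0 + 2 e1\<close>,
  \<open>C - B = 3 e1 + e2\<close> and \<open>A - C = 4 e2 + e0\<close>. Each of these lies in the sector after its first
  direction; since the first coefficient is the larger one, eliminating the first direction
  shows that the reversed side, for instance \<open>A - B = 2 e1 + 4 e2\<close>, lies in the next sector. So
  both sides at a vertex point into the same sector. Unlike for the equilateral triangle, which
  has the same property when suitably rotated, the squared side lengths \<open>12\<close>, \<open>7\<close>, \<open>13\<close> are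
  distinct, as general position demands.
\<close>

definition triangle_A :: point where "triangle_A = (0, 0)"
definition triangle_B :: point where "triangle_B = (3, sqrt 3)"
definition triangle_C :: point where "triangle_C = (1, 2 * sqrt 3)"

lemmas triangle_defs = triangle_A_def triangle_B_def triangle_C_def

lemma direction_3:
  "direction 3 0 = (1, 0)" "direction 3 1 = (- 1 / 2, sqrt 3 / 2)"
  "direction 3 2 = (- 1 / 2, - sqrt 3 / 2)" "direction 3 3 = (1, 0)"
proof -
  show "direction 3 0 = (1, 0)" "direction 3 1 = (- 1 / 2, sqrt 3 / 2)" "direction 3 3 = (1, 0)"
    by (simp_all add: direction_def cos_120 sin_120)
  have "2 * pi * 2 / real 3 = pi / 3 + pi" by simp
  hence "cos (2 * pi * 2 / real 3) = - cos (pi / 3)" "sin (2 * pi * 2 / real 3) = - sin (pi / 3)"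
    by (metis cos_periodic_pi, metis sin_periodic_pi)
  thus "direction 3 2 = (- 1 / 2, - sqrt 3 / 2)"
    by (simp add: direction_def cos_60 sin_60)
qed

lemma triangle_sectors:
  "triangle_B \<in> sector 3 0 triangle_A" "triangle_C \<in> sector 3 0 triangle_A"
  "triangle_C \<in> sector 3 1 triangle_B" "triangle_A \<in> sector 3 1 triangle_B"
  "triangle_A \<in> sector 3 2 triangle_C" "triangle_B \<in> sector 3 2 triangle_C"
  by (rule positive_combination_in_sector[of 3 4 2] positive_combination_in_sector[of 3 3 4]
      positive_combination_in_sector[of 3 3 1] positive_combination_in_sector[of 3 2 4]
      positive_combination_in_sector[of 3 4 1] positive_combination_in_sector[of 3 2 3];
      simp add: triangle_defs direction_3; fail)+

lemma triangle_dist: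
  "dist triangle_A triangle_B = sqrt 12" "dist triangle_B triangle_C = sqrt 7"
  "dist triangle_A triangle_C = sqrt 13"
  by (simp_all add: triangle_defs dist_Pair_Pair dist_real_def power_mult_distrib)

lemma triangle_distinct:
  "triangle_A \<noteq> triangle_B" "triangle_B \<noteq> triangle_C" "triangle_A \<noteq> triangle_C"
  by (simp_all add: triangle_defs)

lemma triangle_in_general_position:
  "general_position 3 {triangle_A, triangle_B, triangle_C}"
proof (rule general_positionI)
  fix p q
  assume "p \<in> {triangle_A, triangle_B, triangle_C}" "q \<in> {triangle_A, triangle_B, triangle_C}" "p \<noteq> q"
  hence "q \<in> sector 3 0 p \<or> q \<in> sector 3 1 p \<or> q \<in> sector 3 2 p"
    using triangle_sectors by auto
  thus "\<exists>i<3. q \<in> sector 3 i p"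
    by (elim disjE) (rule exI, erule conjI[rotated], simp)+
next
  fix p q r :: point and i
  assume "p \<in> {triangle_A, triangle_B, triangle_C}" "q \<in> {triangle_A, triangle_B, triangle_C}"
    "r \<in> {triangle_A, triangle_B, triangle_C}" "q \<noteq> r" "q \<in> sector 3 i p" "r \<in> sector 3 i p"
  moreover have "p \<noteq> q" "p \<noteq> r"
    using calculation not_in_own_sector[of 3 p i] by (metis zero_less_numeral)+
  ultimately show "dist p q \<noteq> dist p r"
    using triangle_dist by (auto simp: dist_commute)
qed simp

lemma triangle_occupied_sectors:
  assumes "p \<in> {triangle_A, triangle_B, triangle_C}"
  shows "card (occupied_sectors 3 {triangle_A, triangle_B, triangle_C} p) \<le> 1"
proof -
  have "\<exists>i\<in>{0, 1, 2}. \<forall>q\<in>{triangle_A, triangle_B, triangle_C} - {p}. q \<in> sector 3 i p"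
    using assms
  proof (elim insertE emptyE)
    assume "p = triangle_A"
    thus ?thesis using triangle_sectors by (intro bexI[of _ 0]) auto
  next
    assume "p = triangle_B"
    thus ?thesis using triangle_sectors by (intro bexI[of _ 1]) auto
  next
    assume "p = triangle_C"
    thus ?thesis using triangle_sectors by (intro bexI[of _ 2]) auto
  qed
  then obtain i where "i \<in> {0, 1, 2}"
    and sec: "\<forall>q\<in>{triangle_A, triangle_B, triangle_C} - {p}. q \<in> sector 3 i p"
    by blast
  hence "i < 3" by auto
  have "occupied_sectors 3 {triangle_A, triangle_B, triangle_C} p \<subseteq> {i}"
  proof
    fix j assume "j \<in> occupied_sectors 3 {triangle_A, triangle_B, triangle_C} p"
    then obtain q where q: "j < 3" "q \<in> sector 3 j p" "q \<in> {triangle_A, triangle_B, triangle_C}"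
      unfolding occupied_sectors_def by blast
    hence "q \<noteq> p" using not_in_own_sector[of 3 p j] by auto
    hence "q \<in> sector 3 i p" using sec q(3) by blast
    thus "j \<in> {i}" using sector_index_unique[of 3 i j q p] q \<open>i < 3\<close> by simp
  qed
  hence "card (occupied_sectors 3 {triangle_A, triangle_B, triangle_C} p) \<le> card {i}"
    by (intro card_mono) auto
  thus ?thesis by simp
qed

section \<open>The value of \<open>W\<close>\<close>

lemma W_eqI:
  assumes "k > 0"
    and lower: "\<And>P. finite P \<Longrightarrow> card P = n \<Longrightarrow> general_position k P \<Longrightarrow>
      \<exists>ps\<in>permutations_of_set P. has_yao_clique k ps (d + 1)"
    and P: "finite P" "card P = n" "general_position k P"
    and occ: "\<And>p. p \<in> P \<Longrightarrow> card (occupied_sectors k P p) \<le> d"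
  shows "W k n = d + 1"
  unfolding W_def
proof (rule Greatest_equality)
  show "\<forall>P. finite P \<and> card P = n \<and> general_position k P \<longrightarrow>
      (\<exists>ps\<in>permutations_of_set P. has_yao_clique k ps (d + 1))"
    using lower by blast
next
  fix m
  assume "\<forall>P. finite P \<and> card P = n \<and> general_position k P \<longrightarrow>
      (\<exists>ps\<in>permutations_of_set P. has_yao_clique k ps m)"
  then obtain ps where "ps \<in> permutations_of_set P" "has_yao_clique k ps m"
    using P by blast
  thus "m \<le> d + 1"
    using clique_card_le_occupied_sectors[OF assms(1) P(3)] occ by blast
qed

theorem theorem4:
  shows "(\<forall>k n :: nat. k \<ge> 2 \<and> n \<ge> 3 \<and> (k, n) \<noteq> (3, 3) \<longrightarrow> W k n = 3) \<and> W 3 3 = 2"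
proof (intro conjI allI impI)
  fix k n :: nat
  assume *: "k \<ge> 2 \<and> n \<ge> 3 \<and> (k, n) \<noteq> (3, 3)"
  have "W k n = 2 + 1"
  proof (rule W_eqI[where P = "line_point k ` {..<n}"])
    show "\<exists>ps\<in>permutations_of_set P. has_yao_clique k ps (2 + 1)"
      if "finite P" "card P = n" "general_position k P" for P
      using order_with_triangle[of k P] * that by simp
  qed (use * in \<open>simp_all add: line_in_general_position line_occupied_sectors card_line\<close>)
  thus "W k n = 3" by simp
next
  have "W 3 3 = 1 + 1"
  proof (rule W_eqI[where P = "{triangle_A, triangle_B, triangle_C}"])
    show "\<exists>ps\<in>permutations_of_set P. has_yao_clique 3 ps (1 + 1)"
      if "finite P" "card P = 3" "general_position 3 P" for P
      unfolding one_add_one using order_with_adjacent_pair[of 3 P] that by simp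
  qed (use triangle_occupied_sectors in
      \<open>simp_all add: triangle_in_general_position triangle_distinct\<close>)
  thus "W 3 3 = 2" by simp
qed

end
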